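(* Suppose that for every initial state $s_0=\xi\sim\mu$, $\sup_{\pi\in\Pi}\mathbb{E}^{\pi}\big[\sum_{t=0}^\infty\gamma^t|r(s_t,\mu_t,a_t,\nu_t)|\big]<\infty$. Then the value function $v$ satisfies the Bellman equation $$v(\mu)=\sup_{h\in\mathcal{H}}\big\{\widehat r(\mu,h)+\gamma\,v(\Phi(\mu,h))\big\}\qquad\text{for any }\mu\in\mathcal{P}(\mathcal{S}).$$
   Context: Setting (mean-field control, MFC). $(\mathcal{S},d_{\mathcal{S}})$ and $(\mathcal{A},d_{\mathcal{A}})$ are compact separable metric spaces (state and action spaces); for such a space $X$, $\mathcal{P}(X)$ is the set of Borel probability measures on $X$ with the topology of weak convergence, metrized by the Wasserstein-1 distance, and its Borel $\sigma$-field. $\gamma\in(0,1)$ is a discount factor. $P:\mathcal{S}\times\mathcal{P}(\mathcal{S})\times\mathcal{A}\times\mathcal{P}(\mathcal{A})\to\mathcal{P}(\mathcal{S})$ (transition) and $R:\mathcal{S}\times\mathcal{P}(\mathcal{S})\times\mathcal{A}\times\mathcal{P}(\mathcal{A})\to\mathcal{P}(\mathbb{R})$ (reward law) are measurable. The underlying probability space $(\Omega,\mathcal{F},\mathbb{P})$ is Polish and atomless, rich enough that every $\mu\in\mathcal{P}(\mathcal{S})$ is the law of some $\mathcal{S}$-valued random variable. An admissible control $\pi=\{\pi_t\}_{t\ge 0}$ is a sequence of measurable maps $\pi_t:\mathcal{S}\times\mathcal{P}(\mathcal{S})\to\mathcal{P}(\mathcal{A})$ (relaxed feedback controls); $\Pi$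 is the set of such sequences. Given $\pi$ and an initial state $s_0=\xi\sim\mu$, the dynamics are $$a_t\sim\pi_t(s_t,\mu_t),\quad s_{t+1}\sim P(s_t,\mu_t,a_t,\nu_t),\quad r(s_t,\mu_t,a_t,\nu_t)\sim R(s_t,\mu_t,a_t,\nu_t),$$ where $\mu_t$ is the law of $s_t$ and $\nu_t$ is the law of $a_t$, so $\nu_t(\cdot)=\int_{\mathcal{S}}\pi_t(s,\mu_t)(\cdot)\,\mu_t(ds)$. $\mathbb{E}^\pi$ is expectation under control $\pi$. For an $\mathcal{S}$-valued random variable $\xi$, $V^\pi(\xi)=\mathbb{E}^\pi\big[\sum_{t=0}^\infty\gamma^t r(s_t,\mu_t,a_t,\nu_t)\,\big|\,s_0=\xi\big]$ depends on $\xi$ only through its law $\mu$ and is written $v^\pi(\mu)$. The value function is $v(\mu)=\sup_{\pi\in\Pi}v^\pi(\mu)$. $\mathcal{H}$ is the set of measurable maps $h:\mathcal{S}\to\mathcal{P}(\mathcal{A})$ (local policies) for which the integrability assumption stated in the claim holds. A control $\pi_t$ is also viewed as a measurable map $\mathcal{P}(\mathcal{S})\to\mathcal{H}$, $\pi_t(\mu)(s)=\pi_t(s,\mu)$. For $(\mu,h)\in\mathcal{P}(\mathcal{S})\times\mathcal{H}$ define $\nu(\mu,h)(\cdot)=\int_{\mathcal{S}}h(s)(\cdot)\,\mu(ds)\in\mathcal{P}(\mathcal{A})$, $$\Phi(\mu,h)(ds')=\int_{\mathcal{S}}\mu(ds)\int_{\mathcal{A}}h(s)(da)\,P(s,\mu,a,\nu(\mu,h))(ds'),$$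 $$\widehat r(\mu,h)=\int_{\mathcal{S}}\mu(ds)\int_{\mathcal{A}}h(s)(da)\int_{\mathbb{R}}r\,R(s,\mu,a,\nu(\mu,h))(dr).$$ *)

theory Defs
  imports "HOL-Probability.Probability"
begin

section \<open>The space of Borel probability measures\<close>

definition prob_measures :: "'a::topological_space measure set" where
  "prob_measures = {M. sets M = sets borel \<and> prob_space M}"

text \<open>
  On a compact metric space this topology is the one induced by the Wasserstein-1 distance.
\<close>

definition weak_topology :: "'a::topological_space measure topology" where
  "weak_topology = topology_generated_by
     {{M \<in> prob_measures. (\<integral>x. f x \<partial>M) \<in> U} | (f :: 'a \<Rightarrow> real) U.
        continuous_on UNIV f \<and> bounded (range f) \<and> open U}"

definition weak_borel :: "'a::topological_space measure measure" where
  "weak_borel = sigma prob_measures {U. openin weak_topology U}"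

section \<open>Atomless and rich probability spaces\<close>

definition atomless :: "'w measure \<Rightarrow> bool" where
  "atomless M \<longleftrightarrow> (\<forall>A\<in>sets M. 0 < measure M A \<longrightarrow>
     (\<exists>B\<in>sets M. B \<subseteq> A \<and> 0 < measure M B \<and> measure M B < measure M A))"

definition realizes_all_laws :: "'w measure \<Rightarrow> 's::topological_space itself \<Rightarrow> bool" where
  "realizes_all_laws M _ \<longleftrightarrow>
     (\<forall>\<mu> \<in> (prob_measures :: 's measure set). \<exists>\<xi> \<in> borel_measurable M. distr M borel \<xi> = \<mu>)"

section \<open>Mean-field control problem\<close>

text \<open>
  The transition \<open>P\<close> and the reward law \<open>R\<close> take a tuple
  \<open>(s, \<mu>, a, \<nu>)\<close> of a state, a state law, an action and an action law.
\<close>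

type_synonym ('s, 'a) mf_point = "'s \<times> 's measure \<times> 'a \<times> 'a measure"

definition mf_points ::
  "('s::topological_space, 'a::topological_space) mf_point measure" where
  "mf_points = borel \<Otimes>\<^sub>M weak_borel \<Otimes>\<^sub>M borel \<Otimes>\<^sub>M weak_borel"

definition controls ::
  "(nat \<Rightarrow> 's::topological_space \<times> 's measure \<Rightarrow> 'a::topological_space measure) set" where
  "controls = {\<pi>. \<forall>t. \<pi> t \<in> borel \<Otimes>\<^sub>M weak_borel \<rightarrow>\<^sub>M weak_borel}"

definition action_law :: "'s measure \<Rightarrow> ('s \<Rightarrow> 'a measure) \<Rightarrow> 'a measure" where
  "action_law \<mu> h = \<mu> \<bind> h"

definition next_law ::
  "(('s, 'a) mf_point \<Rightarrow> 's measure) \<Rightarrow> 's measure \<Rightarrow> ('s \<Rightarrow> 'a measure) \<Rightarrow> 's measure" where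
  "next_law P \<mu> h = \<mu> \<bind> (\<lambda>s. h s \<bind> (\<lambda>a. P (s, \<mu>, a, action_law \<mu> h)))"

definition mean_reward ::
  "(('s, 'a) mf_point \<Rightarrow> real measure) \<Rightarrow> 's measure \<Rightarrow> ('s \<Rightarrow> 'a measure) \<Rightarrow> real" where
  "mean_reward R \<mu> h = (\<integral>s. (\<integral>a. (\<integral>r. r \<partial>R (s, \<mu>, a, action_law \<mu> h)) \<partial>h s) \<partial>\<mu>)"

text \<open>
  The laws \<open>\<mu>\<^sub>t\<close> and \<open>\<nu>\<^sub>t\<close> of \<open>s\<^sub>t\<close> and \<open>a\<^sub>t\<close>, on which the dynamics depend, are
  computed first; the process is then built from them.  Lemma \<open>distr_trajectory\<close> below shows
  that they are indeed the laws of the state and the action of the process.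
\<close>

primrec state_flow ::
  "(('s, 'a) mf_point \<Rightarrow> 's measure) \<Rightarrow> (nat \<Rightarrow> 's \<times> 's measure \<Rightarrow> 'a measure) \<Rightarrow>
    's measure \<Rightarrow> nat \<Rightarrow> 's measure" where
  "state_flow P \<pi> \<mu> 0 = \<mu>"
| "state_flow P \<pi> \<mu> (Suc t) =
     next_law P (state_flow P \<pi> \<mu> t) (\<lambda>s. \<pi> t (s, state_flow P \<pi> \<mu> t))"

definition action_flow ::
  "(('s, 'a) mf_point \<Rightarrow> 's measure) \<Rightarrow> (nat \<Rightarrow> 's \<times> 's measure \<Rightarrow> 'a measure) \<Rightarrow>
    's measure \<Rightarrow> nat \<Rightarrow> 'a measure" where
  "action_flow P \<pi> \<mu> t =
     action_law (state_flow P \<pi> \<mu> t) (\<lambda>s. \<pi> t (s, state_flow P \<pi> \<mu> t))"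

abbreviation stages ::
  "('s::topological_space \<times> 'a::topological_space \<times> real) measure" where
  "stages \<equiv> borel \<Otimes>\<^sub>M borel \<Otimes>\<^sub>M borel"

text \<open>Conditional law of \<open>(s\<^sub>t, a\<^sub>t, r\<^sub>t)\<close> given \<open>s\<^sub>t = s\<close>.\<close>

definition stage_law ::
  "(('s::topological_space, 'a::topological_space) mf_point \<Rightarrow> 's measure) \<Rightarrow>
    (('s, 'a) mf_point \<Rightarrow> real measure) \<Rightarrow> (nat \<Rightarrow> 's \<times> 's measure \<Rightarrow> 'a measure) \<Rightarrow>
    's measure \<Rightarrow> nat \<Rightarrow> 's \<Rightarrow> ('s \<times> 'a \<times> real) measure" where
  "stage_law P R \<pi> \<mu> t s =
     \<pi> t (s, state_flow P \<pi> \<mu> t) \<bind>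
       (\<lambda>a. R (s, state_flow P \<pi> \<mu> t, a, action_flow P \<pi> \<mu> t) \<bind>
       (\<lambda>r. return stages (s, a, r)))"

text \<open>Conditional law of \<open>s\<^sub>t\<close> given the history \<open>\<omega>\<close> of the triples before \<open>t\<close>.\<close>

definition state_kernel ::
  "(('s, 'a) mf_point \<Rightarrow> 's measure) \<Rightarrow> (nat \<Rightarrow> 's \<times> 's measure \<Rightarrow> 'a measure) \<Rightarrow>
    's measure \<Rightarrow> nat \<Rightarrow> (nat \<Rightarrow> 's \<times> 'a \<times> real) \<Rightarrow> 's measure" where
  "state_kernel P \<pi> \<mu> t \<omega> =
     (case t of 0 \<Rightarrow> \<mu>
      | Suc u \<Rightarrow> P (fst (\<omega> u), state_flow P \<pi> \<mu> u, fst (snd (\<omega> u)), action_flow P \<pi> \<mu> u))"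

definition stage_kernel ::
  "(('s::topological_space, 'a::topological_space) mf_point \<Rightarrow> 's measure) \<Rightarrow>
    (('s, 'a) mf_point \<Rightarrow> real measure) \<Rightarrow> (nat \<Rightarrow> 's \<times> 's measure \<Rightarrow> 'a measure) \<Rightarrow>
    's measure \<Rightarrow> nat \<Rightarrow> (nat \<Rightarrow> 's \<times> 'a \<times> real) \<Rightarrow> ('s \<times> 'a \<times> real) measure" where
  "stage_kernel P R \<pi> \<mu> t \<omega> = state_kernel P \<pi> \<mu> t \<omega> \<bind> stage_law P R \<pi> \<mu> t"

text \<open>Law of the process \<open>(s\<^sub>t, a\<^sub>t, r\<^sub>t)\<^sub>t\<close> under the control \<open>\<pi>\<close> when \<open>s\<^sub>0\<close> has law \<open>\<mu>\<close>.\<close>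

definition trajectory ::
  "(('s::topological_space, 'a::topological_space) mf_point \<Rightarrow> 's measure) \<Rightarrow>
    (('s, 'a) mf_point \<Rightarrow> real measure) \<Rightarrow> (nat \<Rightarrow> 's \<times> 's measure \<Rightarrow> 'a measure) \<Rightarrow>
    's measure \<Rightarrow> (nat \<Rightarrow> 's \<times> 'a \<times> real) measure" where
  "trajectory P R \<pi> \<mu> =
     projective_family.lim UNIV
       (Ionescu_Tulcea.CI (stage_kernel P R \<pi> \<mu>) (\<lambda>_. stages)) (\<lambda>_. stages)"

definition reward :: "(nat \<Rightarrow> 's \<times> 'a \<times> real) \<Rightarrow> nat \<Rightarrow> real" where
  "reward \<omega> t = snd (snd (\<omega> t))"

definition control_value ::
  "real \<Rightarrow> (('s::topological_space, 'a::topological_space) mf_point \<Rightarrow> 's measure) \<Rightarrow>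
    (('s, 'a) mf_point \<Rightarrow> real measure) \<Rightarrow> (nat \<Rightarrow> 's \<times> 's measure \<Rightarrow> 'a measure) \<Rightarrow>
    's measure \<Rightarrow> real" where
  "control_value \<gamma> P R \<pi> \<mu> =
     (\<integral>\<omega>. (\<Sum>t. \<gamma> ^ t * reward \<omega> t) \<partial>trajectory P R \<pi> \<mu>)"

definition control_abs_value ::
  "real \<Rightarrow> (('s::topological_space, 'a::topological_space) mf_point \<Rightarrow> 's measure) \<Rightarrow>
    (('s, 'a) mf_point \<Rightarrow> real measure) \<Rightarrow> (nat \<Rightarrow> 's \<times> 's measure \<Rightarrow> 'a measure) \<Rightarrow>
    's measure \<Rightarrow> ennreal" where
  "control_abs_value \<gamma> P R \<pi> \<mu> =
     (\<integral>\<^sup>+\<omega>. (\<Sum>t. ennreal (\<gamma> ^ t * \<bar>reward \<omega> t\<bar>)) \<partial>trajectory P R \<pi> \<mu>)"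

text \<open>The supremum is taken in the extended reals, where it always exists.\<close>

definition optimal_value ::
  "real \<Rightarrow> (('s::topological_space, 'a::topological_space) mf_point \<Rightarrow> 's measure) \<Rightarrow>
    (('s, 'a) mf_point \<Rightarrow> real measure) \<Rightarrow> 's measure \<Rightarrow> ereal" where
  "optimal_value \<gamma> P R \<mu> = (SUP \<pi>\<in>controls. ereal (control_value \<gamma> P R \<pi> \<mu>))"

text \<open>
  The integrability required of a local policy \<open>h\<close> is the one required of the whole problem,
  restricted to the controls that apply \<open>h\<close> at time \<open>0\<close>.
\<close>

definition local_policies ::
  "real \<Rightarrow> (('s::topological_space, 'a::topological_space) mf_point \<Rightarrow> 's measure) \<Rightarrow>
    (('s, 'a) mf_point \<Rightarrow> real measure) \<Rightarrow> ('s \<Rightarrow> 'a measure) set" where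
  "local_policies \<gamma> P R =
     {h \<in> borel \<rightarrow>\<^sub>M weak_borel. \<forall>\<mu>\<in>prob_measures.
        (SUP \<pi>\<in>{\<pi> \<in> controls. \<forall>s. \<forall>m\<in>prob_measures. \<pi> 0 (s, m) = h s}.
           control_abs_value \<gamma> P R \<pi> \<mu>) < \<infinity>}"

section \<open>The flow consists of the laws of the process\<close>

lemma space_weak_borel [simp]: "space weak_borel = prob_measures"
  unfolding weak_borel_def by (rule space_measure_of_conv)

lemma topspace_weak_topology [simp]: "topspace weak_topology = prob_measures"
proof -
  have "prob_measures = {M \<in> (prob_measures :: 'a measure set). (\<integral>x. (0::real) \<partial>M) \<in> UNIV}"
    by simp
  then have "\<exists>(f::'a \<Rightarrow> real) U. prob_measures = {M \<in> prob_measures. (\<integral>x. f x \<partial>M) \<in> U}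
      \<and> continuous_on UNIV f \<and> bounded (range f) \<and> open U"
    by (intro exI[of _ "\<lambda>_. 0"] exI[of _ UNIV]) auto
  then show ?thesis
    unfolding weak_topology_def topology_generated_by_topspace by blast
qed

lemma measurable_integral_weak_borel:
  fixes f :: "'a::topological_space \<Rightarrow> real"
  assumes "continuous_on UNIV f" "bounded (range f)"
  shows "(\<lambda>M. \<integral>x. f x \<partial>M) \<in> borel_measurable weak_borel"
proof (rule borel_measurableI)
  fix U :: "real set" assume "open U"
  then have "openin weak_topology {M \<in> prob_measures. (\<integral>x. f x \<partial>M) \<in> U}"
    unfolding weak_topology_def
    by (intro topology_generated_by_Basis) (use assms in blast)
  moreover have "{U. openin weak_topology U} \<subseteq> Pow (prob_measures :: 'a measure set)"
    using openin_subset[of weak_topology] by auto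
  ultimately have "{M \<in> prob_measures. (\<integral>x. f x \<partial>M) \<in> U} \<in> sets weak_borel"
    unfolding weak_borel_def by auto
  also have "{M \<in> prob_measures. (\<integral>x. f x \<partial>M) \<in> U}
      = (\<lambda>M. \<integral>x. f x \<partial>M) -` U \<inter> space weak_borel"
    by auto
  finally show "(\<lambda>M. \<integral>x. f x \<partial>M) -` U \<inter> space weak_borel \<in> sets weak_borel" .
qed

lemma measurable_weak_borel_prob_algebra:
  "(\<lambda>M. M) \<in> weak_borel \<rightarrow>\<^sub>M prob_algebra (borel :: 'a::metric_space measure)"
proof (rule measurable_prob_algebra_generated[where G = "{U. open U}" and \<Omega> = UNIV])
  show "sets (borel :: 'a measure) = sigma_sets UNIV {U. open U}"
    by (simp add: borel_def)
  show "Int_stable {U :: 'a set. open U}"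
    by (auto simp: Int_stable_def)
next
  fix U :: "'a set" assume "U \<in> {U. open U}"
  then have U: "open U" by simp
  define f where "f n x = min 1 (real n * infdist x (- U))" for n and x :: 'a
  have cont: "continuous_on UNIV (f n)" for n
    unfolding f_def by (intro continuous_intros)
  have bnd: "0 \<le> f n x" "f n x \<le> 1" for n x
    unfolding f_def by (auto simp: infdist_nonneg)
  have bd: "bounded (range (f n))" for n
    using bnd by (intro boundedI[of _ 1]) (auto simp: abs_le_iff intro: order_trans[of _ 0])
  have lim: "(\<lambda>n. f n x) \<longlonglongrightarrow> indicat_real U x" if "- U \<noteq> {}" for x
  proof (cases "x \<in> U")
    case False
    then show ?thesis by (simp add: f_def)
  next
    case True
    have "infdist x (- U) \<noteq> 0"
      using in_closed_iff_infdist_zero[of "- U" x] U that True by (auto simp: closed_def)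
    then have d: "0 < infdist x (- U)"
      using infdist_nonneg[of x "- U"] by simp
    then obtain N where N: "1 < real N * infdist x (- U)"
      using reals_Archimedean3 by blast
    have "f n x = 1" if "N \<le> n" for n
    proof -
      have "real N * infdist x (- U) \<le> real n * infdist x (- U)"
        using that d by (intro mult_right_mono) auto
      then show ?thesis using N by (simp add: f_def)
    qed
    then have "\<forall>\<^sub>F n in sequentially. f n x = 1"
      by (auto simp: eventually_sequentially)
    then show ?thesis using True by (auto intro: tendsto_eventually)
  qed
  have "(\<lambda>M. measure M U) \<in> borel_measurable weak_borel"
  proof (cases "- U = {}")
    case True
    then have "U = UNIV" by auto
    have "(\<lambda>M. 1 :: real) \<in> borel_measurable weak_borel" by simp
    moreover have "measure M U = 1" if "M \<in> space weak_borel" for M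
    proof -
      have "space M = UNIV" "prob_space M"
        using that sets_eq_imp_space_eq[of M borel] by (auto simp: prob_measures_def)
      then show ?thesis
        using prob_space.prob_space[of M] \<open>U = UNIV\<close> by simp
    qed
    ultimately show ?thesis
      using measurable_cong[of weak_borel "\<lambda>M. measure M U" "\<lambda>_. 1"] by blast
  next
    case False
    show ?thesis
    proof (rule borel_measurable_LIMSEQ_real[where u = "\<lambda>n M. \<integral>x. f n x \<partial>M"])
      show "(\<lambda>M. \<integral>x. f n x \<partial>M) \<in> borel_measurable weak_borel" for n
        by (rule measurable_integral_weak_borel[OF cont bd])
      fix M :: "'a measure" assume "M \<in> space weak_borel"
      then have M: "sets M = sets borel" and "prob_space M"
        by (auto simp: prob_measures_def)
      interpret M: prob_space M by fact
      have mf: "g \<in> borel_measurable M" if "g \<in> borel_measurable borel" for g :: "'a \<Rightarrow> real"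
        using that measurable_cong_sets[OF M, of borel] by blast
      have "(\<lambda>n. \<integral>x. f n x \<partial>M) \<longlonglongrightarrow> (\<integral>x. indicat_real U x \<partial>M)"
      proof (rule integral_dominated_convergence[where w = "\<lambda>_. 1"])
        show "indicat_real U \<in> borel_measurable M"
          using U by (intro mf) auto
        show "f n \<in> borel_measurable M" for n
          using cont by (intro mf borel_measurable_continuous_onI)
        show "AE x in M. (\<lambda>n. f n x) \<longlonglongrightarrow> indicat_real U x"
          using lim[OF False] by simp
        show "AE x in M. norm (f n x) \<le> 1" for n
          using bnd by simp
      qed simp
      then show "(\<lambda>n. \<integral>x. f n x \<partial>M) \<longlonglongrightarrow> measure M U"
        using sets_eq_imp_space_eq[OF M] by simp
    qed
  qed
  then have "(\<lambda>M. ennreal (measure M U)) \<in> borel_measurable weak_borel"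
    by simp
  moreover have "emeasure M U = ennreal (measure M U)" if "M \<in> space weak_borel" for M
    using that by (auto simp: prob_measures_def intro!: finite_measure.emeasure_eq_measure
        prob_space.finite_measure)
  ultimately show "(\<lambda>M. emeasure M U) \<in> borel_measurable weak_borel"
    using measurable_cong[of weak_borel "\<lambda>M. emeasure M U" "\<lambda>M. ennreal (measure M U)"] by blast
qed (auto simp: prob_measures_def)

lemma prob_measures_eq: "prob_measures = space (prob_algebra borel)"
  by (auto simp: prob_measures_def space_prob_algebra)

context
  fixes P :: "('s::{metric_space, second_countable_topology},
               'a::{metric_space, second_countable_topology}) mf_point \<Rightarrow> 's measure"
    and R :: "('s, 'a) mf_point \<Rightarrow> real measure"
    and \<pi> :: "nat \<Rightarrow> 's \<times> 's measure \<Rightarrow> 'a measure"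
    and \<mu> :: "'s measure"
  assumes P: "P \<in> mf_points \<rightarrow>\<^sub>M weak_borel" and R: "R \<in> mf_points \<rightarrow>\<^sub>M weak_borel"
    and \<pi>: "\<pi> \<in> controls" and \<mu>: "\<mu> \<in> prob_measures"
begin

private abbreviation "m \<equiv> state_flow P \<pi> \<mu>"
private abbreviation "n \<equiv> action_flow P \<pi> \<mu>"

lemma measurable_control_section:
  assumes "M \<in> prob_measures"
  shows "(\<lambda>s. \<pi> t (s, M)) \<in> borel \<rightarrow>\<^sub>M prob_algebra borel"
proof -
  have "\<pi> t \<in> borel \<Otimes>\<^sub>M weak_borel \<rightarrow>\<^sub>M prob_algebra borel"
    using \<pi> measurable_compose[OF _ measurable_weak_borel_prob_algebra]
    by (auto simp: controls_def)
  moreover have "(\<lambda>s. (s, M)) \<in> borel \<rightarrow>\<^sub>M borel \<Otimes>\<^sub>M weak_borel"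
    using assms by (intro measurable_Pair) auto
  ultimately show ?thesis by (rule measurable_compose[rotated])
qed

lemma measurable_mf_section:
  assumes Q: "Q \<in> mf_points \<rightarrow>\<^sub>M weak_borel" and "M \<in> prob_measures" "N \<in> prob_measures"
  shows "(\<lambda>x. Q (fst x, M, snd x, N)) \<in> borel \<Otimes>\<^sub>M borel \<rightarrow>\<^sub>M prob_algebra (borel :: 'b::metric_space measure)"
proof -
  have "Q \<in> mf_points \<rightarrow>\<^sub>M prob_algebra borel"
    using measurable_compose[OF Q measurable_weak_borel_prob_algebra] .
  moreover have "(\<lambda>x. (fst x, M, snd x, N)) \<in> borel \<Otimes>\<^sub>M borel \<rightarrow>\<^sub>M mf_points"
    unfolding mf_points_def using assms by (intro measurable_Pair) auto
  ultimately show ?thesis by (rule measurable_compose[rotated])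
qed

lemma action_law_prob_measures:
  assumes "M \<in> prob_measures"
  shows "action_law M (\<lambda>s. \<pi> t (s, M)) \<in> prob_measures"
  using assms prob_space_bind'[OF _ measurable_control_section[OF assms]]
    sets_bind'[OF _ measurable_control_section[OF assms]]
  by (simp add: prob_measures_eq action_law_def space_prob_algebra)

lemma measurable_next:
  assumes "M \<in> prob_measures" "N \<in> prob_measures"
  shows "(\<lambda>s. \<pi> t (s, M) \<bind> (\<lambda>a. P (s, M, a, N))) \<in> borel \<rightarrow>\<^sub>M prob_algebra borel"
  using measurable_mf_section[OF P assms]
  by (intro measurable_bind_prob_space2[OF measurable_control_section[OF assms(1)]])
    (simp add: split_def)

lemma flow_prob_measures: "m t \<in> prob_measures" "n t \<in> prob_measures"
proof -
  show "m t \<in> prob_measures"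
  proof (induction t)
    case (Suc t)
    note nx = measurable_next[OF Suc.IH action_law_prob_measures[OF Suc.IH], of t t]
    show ?case
      using Suc.IH prob_space_bind'[OF _ nx] sets_bind'[OF _ nx]
      by (simp add: prob_measures_eq next_law_def space_prob_algebra)
  qed (use \<mu> in simp)
  then show "n t \<in> prob_measures"
    unfolding action_flow_def by (rule action_law_prob_measures)
qed

lemma measurable_stage_law: "stage_law P R \<pi> \<mu> t \<in> borel \<rightarrow>\<^sub>M prob_algebra stages"
proof -
  have [measurable]: "(\<lambda>s. \<pi> t (s, m t)) \<in> borel \<rightarrow>\<^sub>M prob_algebra borel"
    by (rule measurable_control_section[OF flow_prob_measures(1)])
  have [measurable]: "(\<lambda>x. R (fst x, m t, snd x, n t)) \<in> borel \<Otimes>\<^sub>M borel \<rightarrow>\<^sub>M prob_algebra borel"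
    by (rule measurable_mf_section[OF R flow_prob_measures(1) flow_prob_measures(2)])
  show ?thesis
    unfolding stage_law_def[abs_def]
  proof (rule measurable_bind_prob_space2[where N = borel])
    show "(\<lambda>(s, a). R (s, m t, a, n t) \<bind> (\<lambda>r. return stages (s, a, r)))
        \<in> borel \<Otimes>\<^sub>M borel \<rightarrow>\<^sub>M prob_algebra stages"
      unfolding split_def
      by (rule measurable_bind_prob_space2[where N = borel]) (simp_all add: split_def)
  qed simp
qed

lemma measurable_state_kernel:
  "state_kernel P \<pi> \<mu> t \<in> PiM {0..<t} (\<lambda>_. stages) \<rightarrow>\<^sub>M prob_algebra borel"
proof (cases t)
  case 0
  then show ?thesis
    using \<mu> by (simp add: state_kernel_def[abs_def] prob_measures_eq)
next
  case (Suc u)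
  have "(\<lambda>\<omega>. \<omega> u) \<in> PiM {0..<t} (\<lambda>_. stages) \<rightarrow>\<^sub>M (stages :: ('s \<times> 'a \<times> real) measure)"
    using Suc by (intro measurable_component_singleton) simp
  from measurable_compose[OF this, of "\<lambda>x. (fst x, fst (snd x))" "borel \<Otimes>\<^sub>M borel"]
  have "(\<lambda>\<omega>. (fst (\<omega> u), fst (snd (\<omega> u))))
      \<in> PiM {0..<t} (\<lambda>_. stages :: ('s \<times> 'a \<times> real) measure) \<rightarrow>\<^sub>M borel \<Otimes>\<^sub>M borel"
    by simp
  from measurable_compose[OF this measurable_mf_section[OF P flow_prob_measures(1) flow_prob_measures(2)]]
  show ?thesis
    using Suc by (simp add: state_kernel_def[abs_def])
qed

lemma measurable_stage_kernel:
  "stage_kernel P R \<pi> \<mu> t \<in> PiM {0..<t} (\<lambda>_. stages) \<rightarrow>\<^sub>M prob_algebra stages"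
  unfolding stage_kernel_def[abs_def]
  by (rule measurable_bind_prob_space[OF measurable_state_kernel measurable_stage_law])

lemma Ionescu_Tulcea_stage_kernel: "Ionescu_Tulcea (stage_kernel P R \<pi> \<mu>) (\<lambda>_. stages)"
  using measurable_prob_algebraD[OF measurable_stage_kernel] measurable_space[OF measurable_stage_kernel]
  by (intro Ionescu_Tulcea.intro) (auto simp: space_prob_algebra)

interpretation IT: Ionescu_Tulcea "stage_kernel P R \<pi> \<mu>" "\<lambda>_. stages"
  by (rule Ionescu_Tulcea_stage_kernel)

lemma sets_trajectory: "sets (trajectory P R \<pi> \<mu>) = sets (PiM UNIV (\<lambda>_. stages))"
  unfolding trajectory_def by (rule IT.PF.sets_lim)

lemma prob_space_trajectory: "prob_space (trajectory P R \<pi> \<mu>)"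
proof (rule prob_space_distrD)
  show "(\<lambda>\<omega>. restrict \<omega> {}) \<in> trajectory P R \<pi> \<mu> \<rightarrow>\<^sub>M PiM {} (\<lambda>_. stages)"
    unfolding measurable_cong_sets[OF sets_trajectory refl] by (rule measurable_restrict_subset) simp
  show "prob_space (distr (trajectory P R \<pi> \<mu>) (PiM {} (\<lambda>_. stages)) (\<lambda>\<omega>. restrict \<omega> {}))"
    unfolding trajectory_def by (subst IT.distr_lim) (simp_all add: IT.PF.prob_space_P)
qed

text \<open>The one-step characterization of the law of the process.\<close>

lemma distr_trajectory_Suc:
  "distr (trajectory P R \<pi> \<mu>) (PiM {0..<Suc t} (\<lambda>_. stages)) (\<lambda>\<omega>. restrict \<omega> {0..<Suc t}) =
     distr (trajectory P R \<pi> \<mu>) (PiM {0..<t} (\<lambda>_. stages)) (\<lambda>\<omega>. restrict \<omega> {0..<t}) \<bind>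
       (\<lambda>\<omega>. distr (stage_kernel P R \<pi> \<mu> t \<omega>) (PiM {0..<Suc t} (\<lambda>_. stages)) (fun_upd \<omega> t))"
proof -
  have C: "distr (trajectory P R \<pi> \<mu>) (PiM {0..<t} (\<lambda>_. stages)) (\<lambda>\<omega>. restrict \<omega> {0..<t})
      = IT.C 0 t (\<lambda>_. undefined)" for t
  proof -
    have "IT.up_to {0..<t} = t"
      using IT.up_to_iff_Ico[of "{0..<t}"] ivl_subset[of 0 t 0]
      by (metis IT.up_to finite_atLeastLessThan le0 le_antisym linorder_not_le order_refl)
    moreover have "distr (IT.C 0 t (\<lambda>_. undefined)) (PiM {0..<t} (\<lambda>_. stages)) (\<lambda>\<omega>. restrict \<omega> {0..<t})
        = IT.C 0 t (\<lambda>_. undefined)"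
      using IT.distr_C[of t t "\<lambda>_. undefined" 0] by (simp add: space_PiM)
    ultimately show ?thesis
      unfolding trajectory_def by (subst IT.distr_lim) (simp_all add: IT.CI_def)
  qed
  show ?thesis
    unfolding C by (simp add: IT.eP_def[abs_def])
qed

private definition D :: "nat \<Rightarrow> (nat \<Rightarrow> 's \<times> 'a \<times> real) measure" where
  "D t = distr (trajectory P R \<pi> \<mu>) (PiM {0..<t} (\<lambda>_. stages)) (\<lambda>\<omega>. restrict \<omega> {0..<t})"

private lemma measurable_restr:
  "(\<lambda>\<omega>. restrict \<omega> {0..<t}) \<in> trajectory P R \<pi> \<mu> \<rightarrow>\<^sub>M PiM {0..<t} (\<lambda>_. stages)"
  unfolding measurable_cong_sets[OF sets_trajectory refl] by (rule measurable_restrict_subset) simp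

private lemma D: "D t \<in> space (prob_algebra (PiM {0..<t} (\<lambda>_. stages)))"
  using prob_space.prob_space_distr[OF prob_space_trajectory measurable_restr]
  by (simp add: space_prob_algebra D_def)

private lemma D_props: "prob_space (D t)" "sets (D t) = sets (PiM {0..<t} (\<lambda>_. stages))"
    "space (D t) \<noteq> {}"
  using D[of t] prob_space.not_empty by (auto simp: space_prob_algebra)

private lemma measurable_D: "M \<in> PiM {0..<t} (\<lambda>_. stages) \<rightarrow>\<^sub>M N \<Longrightarrow> M \<in> D t \<rightarrow>\<^sub>M N"
  using measurable_cong_sets[OF D_props(2), of N] by blast

private lemma measurable_eval:
  "u < t \<Longrightarrow> (\<lambda>\<omega>. \<omega> u) \<in> PiM {0..<t} (\<lambda>_. stages) \<rightarrow>\<^sub>M (stages :: ('s \<times> 'a \<times> real) measure)"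
  for t u :: nat
  by (intro measurable_component_singleton) simp

private lemma D_Suc_eval:
  "distr (D (Suc t)) stages (\<lambda>\<omega>. \<omega> t) = distr (trajectory P R \<pi> \<mu>) stages (\<lambda>\<omega>. \<omega> t)"
  unfolding D_def
  by (subst distr_distr[OF measurable_eval measurable_restr]) (simp_all add: comp_def)

private lemma distr_trajectory_kernel:
  "distr (trajectory P R \<pi> \<mu>) stages (\<lambda>\<omega>. \<omega> t) = D t \<bind> stage_kernel P R \<pi> \<mu> t"
proof -
  have "distr (D (Suc t)) stages (\<lambda>\<omega>. \<omega> t) = D t \<bind> (\<lambda>\<omega>. distr (IT.eP t \<omega>) stages (\<lambda>\<omega>. \<omega> t))"
    unfolding D_def distr_trajectory_Suc IT.eP_def[symmetric]
    by (rule distr_bind[where K = "PiM {0..<Suc t} (\<lambda>_. stages)"])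
      (use measurable_D[OF IT.measurable_eP] D_props(3)[of t] measurable_eval[of t "Suc t"]
        in \<open>simp_all add: D_def\<close>)
  also have "\<dots> = D t \<bind> stage_kernel P R \<pi> \<mu> t"
  proof (rule bind_cong[OF refl])
    fix \<omega> assume "\<omega> \<in> space (D t)"
    then have \<omega>: "\<omega> \<in> space (PiM {0..<t} (\<lambda>_. stages))"
      using sets_eq_imp_space_eq[OF D_props(2)] by simp
    have s: "sets (stage_kernel P R \<pi> \<mu> t \<omega>) = sets stages"
      by (rule IT.sets_P[OF \<omega>])
    have "fun_upd \<omega> t \<in> stage_kernel P R \<pi> \<mu> t \<omega> \<rightarrow>\<^sub>M PiM {0..<Suc t} (\<lambda>_. stages)"
      unfolding measurable_cong_sets[OF s refl]
      using \<omega> by (intro measurable_fun_upd[where J = "{0..<t}"]) auto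
    then show "distr (IT.eP t \<omega>) stages (\<lambda>\<omega>. \<omega> t) = stage_kernel P R \<pi> \<mu> t \<omega>"
      unfolding IT.eP_def
      by (subst distr_distr[OF measurable_eval]) (simp_all add: comp_def distr_id2 s)
  qed
  finally show ?thesis by (simp add: D_Suc_eval)
qed

text \<open>The joint law of the triple at time \<open>t\<close>.\<close>

lemma distr_trajectory_stage:
  "distr (trajectory P R \<pi> \<mu>) stages (\<lambda>\<omega>. \<omega> t) = m t \<bind> stage_law P R \<pi> \<mu> t"
proof (induction t)
  case 0
  have "subprob_space (\<mu> \<bind> stage_law P R \<pi> \<mu> 0)"
    using prob_space_bind'[OF _ measurable_stage_law] \<mu>
    by (simp add: prob_measures_eq prob_space_imp_subprob_space)
  then show ?case
    unfolding distr_trajectory_kernel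
    by (simp add: stage_kernel_def[abs_def] state_kernel_def bind_const' D_props(1))
next
  case (Suc t)
  define q where "q x = P (fst x, m t, fst (snd x), n t)" for x :: "'s \<times> 'a \<times> real"
  have mt: "sets (m t) = sets borel"
    using flow_prob_measures(1) by (simp add: prob_measures_def)
  have q': "q \<in> stages \<rightarrow>\<^sub>M prob_algebra borel"
    using measurable_compose[OF _ measurable_mf_section[OF P flow_prob_measures(1) flow_prob_measures(2)],
        of "\<lambda>x. (fst x, fst (snd x))" stages t t]
    by (simp add: q_def[abs_def])
  note q = measurable_prob_algebraD[OF q']
  note sl = measurable_prob_algebraD[OF measurable_stage_law]
  have slt: "stage_law P R \<pi> \<mu> u \<in> m t \<rightarrow>\<^sub>M subprob_algebra stages" for u
    using sl measurable_cong_sets[OF mt] by blast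
  have g: "(\<lambda>x. q x \<bind> stage_law P R \<pi> \<mu> (Suc t)) \<in> stages \<rightarrow>\<^sub>M subprob_algebra stages"
    by (rule measurable_bind2[OF q sl])
  have step: "stage_law P R \<pi> \<mu> t s \<bind> q = \<pi> t (s, m t) \<bind> (\<lambda>a. P (s, m t, a, n t))" for s
  proof -
    have pi: "\<pi> t (s, m t) \<in> space (prob_algebra borel)"
      using measurable_space[OF measurable_control_section[OF flow_prob_measures(1)]] by simp
    have R1: "(\<lambda>a. R (s, m t, a, n t)) \<in> borel \<rightarrow>\<^sub>M prob_algebra borel"
      using measurable_compose[OF _ measurable_mf_section[OF R flow_prob_measures(1) flow_prob_measures(2)],
          of "\<lambda>a. (s, a)" borel t t] by simp
    have R2: "(\<lambda>a. R (s, m t, a, n t) \<bind> (\<lambda>r. return stages (s, a, r))) \<in> borel \<rightarrow>\<^sub>M prob_algebra stages"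
      using R1 by (rule measurable_bind_prob_space2) (simp add: split_def)
    have "stage_law P R \<pi> \<mu> t s \<bind> q
        = \<pi> t (s, m t) \<bind> (\<lambda>a. (R (s, m t, a, n t) \<bind> (\<lambda>r. return stages (s, a, r))) \<bind> q)"
      unfolding stage_law_def
      using measurable_prob_algebraD[OF R2] pi measurable_cong_sets[of "\<pi> t (s, m t)" borel]
      by (intro bind_assoc[OF _ q]) (auto simp: space_prob_algebra)
    also have "\<dots> = \<pi> t (s, m t) \<bind> (\<lambda>a. P (s, m t, a, n t))"
    proof (rule bind_cong[OF refl])
      fix a
      have Ra: "sets (R (s, m t, a, n t)) = sets borel" "prob_space (R (s, m t, a, n t))"
        using measurable_space[OF R1] by (auto simp: space_prob_algebra)
      have "(R (s, m t, a, n t) \<bind> (\<lambda>r. return stages (s, a, r))) \<bind> q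
          = R (s, m t, a, n t) \<bind> (\<lambda>r. return stages (s, a, r) \<bind> q)"
        by (rule bind_assoc[OF _ q]) (simp add: measurable_cong_sets[OF Ra(1) refl])
      also have "\<dots> = R (s, m t, a, n t) \<bind> (\<lambda>r. P (s, m t, a, n t))"
        by (rule bind_cong[OF refl], subst bind_return[OF q])
          (simp_all add: q_def space_pair_measure)
      also have "\<dots> = P (s, m t, a, n t)"
        using measurable_space[OF q', of "(s, a, 0)"]
        by (intro bind_const' Ra) (simp add: q_def space_prob_algebra space_pair_measure
            prob_space_imp_subprob_space)
      finally show "(R (s, m t, a, n t) \<bind> (\<lambda>r. return stages (s, a, r))) \<bind> q = P (s, m t, a, n t)" .
    qed
    finally show ?thesis .
  qed
  have "distr (trajectory P R \<pi> \<mu>) stages (\<lambda>\<omega>. \<omega> (Suc t))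
      = D (Suc t) \<bind> (\<lambda>\<omega>. q (\<omega> t) \<bind> stage_law P R \<pi> \<mu> (Suc t))"
    unfolding distr_trajectory_kernel
    by (simp add: stage_kernel_def[abs_def] state_kernel_def q_def)
  also have "\<dots> = distr (D (Suc t)) stages (\<lambda>\<omega>. \<omega> t) \<bind> (\<lambda>x. q x \<bind> stage_law P R \<pi> \<mu> (Suc t))"
    by (rule bind_distr[OF _ g D_props(3), symmetric]) (rule measurable_D[OF measurable_eval], simp)
  also have "\<dots> = (m t \<bind> stage_law P R \<pi> \<mu> t) \<bind> (\<lambda>x. q x \<bind> stage_law P R \<pi> \<mu> (Suc t))"
    by (simp only: D_Suc_eval Suc.IH)
  also have "\<dots> = ((m t \<bind> stage_law P R \<pi> \<mu> t) \<bind> q) \<bind> stage_law P R \<pi> \<mu> (Suc t)"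
  proof (rule bind_assoc[OF _ sl, symmetric])
    have "sets (m t \<bind> stage_law P R \<pi> \<mu> t) = sets stages"
      using flow_prob_measures(1)
      by (intro sets_bind'[OF _ measurable_stage_law]) (simp add: prob_measures_eq)
    then show "q \<in> (m t \<bind> stage_law P R \<pi> \<mu> t) \<rightarrow>\<^sub>M subprob_algebra borel"
      using q measurable_cong_sets by blast
  qed
  also have "(m t \<bind> stage_law P R \<pi> \<mu> t) \<bind> q = m (Suc t)"
    by (subst bind_assoc[OF slt q]) (simp add: step next_law_def action_flow_def)
  finally show ?case .
qed

lemma distr_trajectory:
  "distr (trajectory P R \<pi> \<mu>) borel (\<lambda>\<omega>. fst (\<omega> t)) = state_flow P \<pi> \<mu> t"
  "distr (trajectory P R \<pi> \<mu>) borel (\<lambda>\<omega>. fst (snd (\<omega> t))) = action_flow P \<pi> \<mu> t"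
proof -
  let ?K = "stage_law P R \<pi> \<mu> t"
  have mt: "m t \<in> space (prob_algebra borel)" "sets (m t) = sets borel" "prob_space (m t)"
    using flow_prob_measures(1)[of t] by (auto simp: prob_measures_eq space_prob_algebra)
  have ne: "space (m t) \<noteq> {}"
    using mt(3) by (rule prob_space.not_empty)
  have K: "?K \<in> m t \<rightarrow>\<^sub>M subprob_algebra stages"
    using measurable_prob_algebraD[OF measurable_stage_law] measurable_cong_sets[OF mt(2)] by blast
  have ev: "(\<lambda>\<omega>. \<omega> t) \<in> trajectory P R \<pi> \<mu> \<rightarrow>\<^sub>M stages"
    unfolding measurable_cong_sets[OF sets_trajectory refl]
    by (intro measurable_component_singleton) simp
  have marg: "distr (trajectory P R \<pi> \<mu>) borel (\<lambda>\<omega>. f (\<omega> t)) = m t \<bind> (\<lambda>s. distr (?K s) borel f)"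
    if "f \<in> stages \<rightarrow>\<^sub>M borel" for f :: "_ \<Rightarrow> 'b::topological_space"
  proof -
    have "distr (trajectory P R \<pi> \<mu>) borel (\<lambda>\<omega>. f (\<omega> t))
        = distr (distr (trajectory P R \<pi> \<mu>) stages (\<lambda>\<omega>. \<omega> t)) borel f"
      by (subst distr_distr[OF that ev]) (simp add: comp_def)
    also have "\<dots> = m t \<bind> (\<lambda>s. distr (?K s) borel f)"
      unfolding distr_trajectory_stage by (rule distr_bind[OF K ne that])
    finally show ?thesis .
  qed
  have inner: "distr (?K s) borel f = \<pi> t (s, m t) \<bind> (\<lambda>a. return borel (g a))"
    if f: "f \<in> stages \<rightarrow>\<^sub>M borel" and fg: "\<And>a r. f (s, a, r) = g a"
    for s and f :: "_ \<Rightarrow> 'b::topological_space" and g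
  proof -
    have pi: "\<pi> t (s, m t) \<in> space (prob_algebra borel)"
      using measurable_space[OF measurable_control_section[OF flow_prob_measures(1)]] by simp
    have R1: "(\<lambda>a. R (s, m t, a, n t)) \<in> borel \<rightarrow>\<^sub>M prob_algebra borel"
      using measurable_compose[OF _ measurable_mf_section[OF R flow_prob_measures(1) flow_prob_measures(2)],
          of "\<lambda>a. (s, a)" borel t t] by simp
    have R2: "(\<lambda>a. R (s, m t, a, n t) \<bind> (\<lambda>r. return stages (s, a, r))) \<in> borel \<rightarrow>\<^sub>M prob_algebra stages"
      using R1 by (rule measurable_bind_prob_space2) (simp add: split_def)
    have R3: "(\<lambda>a. R (s, m t, a, n t) \<bind> (\<lambda>r. return stages (s, a, r)))
        \<in> \<pi> t (s, m t) \<rightarrow>\<^sub>M subprob_algebra stages"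
      using measurable_prob_algebraD[OF R2] pi measurable_cong_sets[of "\<pi> t (s, m t)" borel]
      by (auto simp: space_prob_algebra)
    have "distr (?K s) borel f
        = \<pi> t (s, m t) \<bind> (\<lambda>a. distr (R (s, m t, a, n t) \<bind> (\<lambda>r. return stages (s, a, r))) borel f)"
      unfolding stage_law_def using pi
      by (intro distr_bind[OF R3 _ f]) (auto simp: space_prob_algebra prob_space.not_empty)
    also have "\<dots> = \<pi> t (s, m t) \<bind> (\<lambda>a. return borel (g a))"
    proof (rule bind_cong[OF refl])
      fix a
      have Ra: "sets (R (s, m t, a, n t)) = sets borel" "prob_space (R (s, m t, a, n t))"
        using measurable_space[OF R1] by (auto simp: space_prob_algebra)
      have "distr (R (s, m t, a, n t) \<bind> (\<lambda>r. return stages (s, a, r))) borel f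
          = R (s, m t, a, n t) \<bind> (\<lambda>r. distr (return stages (s, a, r)) borel f)"
        using prob_space.not_empty[OF Ra(2)]
        by (intro distr_bind[OF _ _ f]) (simp_all add: measurable_cong_sets[OF Ra(1) refl])
      also have "\<dots> = R (s, m t, a, n t) \<bind> (\<lambda>r. return borel (g a))"
        by (rule bind_cong[OF refl], subst distr_return[OF f])
          (simp_all add: fg space_pair_measure)
      also have "\<dots> = return borel (g a)"
        by (intro bind_const' Ra prob_space_imp_subprob_space prob_space_return) simp
      finally show "distr (R (s, m t, a, n t) \<bind> (\<lambda>r. return stages (s, a, r))) borel f
          = return borel (g a)" .
    qed
    finally show ?thesis .
  qed
  have pi: "sets (\<pi> t (s, m t)) = sets borel" "prob_space (\<pi> t (s, m t))" for s
    using measurable_space[OF measurable_control_section[OF flow_prob_measures(1)], of s t t]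
    by (auto simp: space_prob_algebra)
  have "distr (?K s) borel fst = return borel s" for s
  proof -
    have "distr (?K s) borel fst = \<pi> t (s, m t) \<bind> (\<lambda>a. return borel s)"
      by (rule inner) simp_all
    then show ?thesis
      using pi by (simp add: bind_const' prob_space_imp_subprob_space prob_space_return)
  qed
  then show "distr (trajectory P R \<pi> \<mu>) borel (\<lambda>\<omega>. fst (\<omega> t)) = m t"
    by (subst marg) (simp_all add: bind_return'' mt)
  have "distr (?K s) borel (\<lambda>x. fst (snd x)) = \<pi> t (s, m t)" for s
  proof -
    have "distr (?K s) borel (\<lambda>x. fst (snd x)) = \<pi> t (s, m t) \<bind> (\<lambda>a. return borel a)"
      by (rule inner) simp_all
    then show ?thesis
      using pi by (simp add: bind_return'')
  qed
  then show "distr (trajectory P R \<pi> \<mu>) borel (\<lambda>\<omega>. fst (snd (\<omega> t))) = n t"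
    using marg[of "\<lambda>x. fst (snd x)"] by (simp add: action_flow_def action_law_def)
qed

end

end

theory Submission
  imports Defs
begin

text \<open>
  Given the control, the flow of the laws of states and actions is deterministic, and the law at
  time \<open>t\<close> together with the local policy applied at time \<open>t\<close> determines the next law.  So the
  mean-field problem is a deterministic control problem on the space of laws.  Its one-step reward
  is \<^const>\<open>mean_reward\<close>, because the expectation of the reward at time \<open>t\<close> depends only on the
  joint law of the state, the action and the reward at time \<open>t\<close>, which is the state law composed
  with the stage kernel (\<open>expected_reward\<close>).  The hypothesis gives absolute summability at every
  initial law, since every law is realized on the probability space; expectation and discounted
  sum can therefore be interchanged, and the value of a control is the discounted sum of the mean
  rewards along its flow of laws (\<open>control_value_sums\<close>).

  Splitting off the first term of this sum leaves the value of the shifted control started from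
  the next law (\<open>control_value_unfold\<close>).  The two inequalities of the Bellman equation are the two
  directions of this splitting.  A control, evaluated at time \<open>0\<close> at the initial law, gives a
  measurable local policy, and such a policy is integrable by the same summability, which bounds
  all controls at once; the shifted control is worth at most the optimal value.  Conversely a
  local policy followed by an arbitrary control is a control (\<open>controls_prepend\<close>).  Here the next
  law is a single point, not random, so the second control has to be near-optimal only there and
  no measurable selection of near-optimal controls is involved.
\<close>

section \<open>Integration against a composed kernel\<close>

text \<open>
  The nonnegative integral disintegrates without conditions, so the integrals of the positive and
  the negative part of \<open>f\<close> are disintegrated separately and recombined.  For almost every \<open>x\<close>
  both inner integrals are finite; on the exceptional null set the Bochner integral over \<open>K x\<close> is
  \<open>0\<close> by convention, but it remains measurable in \<open>x\<close>.
\<close>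

lemma
  fixes f :: "'b \<Rightarrow> real"
  assumes K[measurable]: "K \<in> M \<rightarrow>\<^sub>M subprob_algebra N"
    and f[measurable]: "f \<in> borel_measurable N" and int: "integrable (M \<bind> K) f"
  shows AE_integrable_kernel: "AE x in M. integrable (K x) f"
    and integral_bind_real: "(\<integral>y. f y \<partial>(M \<bind> K)) = (\<integral>x. (\<integral>y. f y \<partial>K x) \<partial>M)"
proof -
  define p q where "p x = (\<integral>\<^sup>+y. ennreal (f y) \<partial>K x)" and "q x = (\<integral>\<^sup>+y. ennreal (- f y) \<partial>K x)" for x
  have [measurable]: "p \<in> borel_measurable M" "q \<in> borel_measurable M"
    unfolding p_def[abs_def] q_def[abs_def]
    by (auto intro!: measurable_compose[OF K] nn_integral_measurable_subprob_algebra)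
  have P: "(\<integral>\<^sup>+y. ennreal (f y) \<partial>(M \<bind> K)) = (\<integral>\<^sup>+x. p x \<partial>M)"
    and Q: "(\<integral>\<^sup>+y. ennreal (- f y) \<partial>(M \<bind> K)) = (\<integral>\<^sup>+x. q x \<partial>M)"
    unfolding p_def q_def by (rule nn_integral_bind[OF _ K]; simp)+
  have fin: "(\<integral>\<^sup>+x. p x \<partial>M) \<noteq> \<infinity>" "(\<integral>\<^sup>+x. q x \<partial>M) \<noteq> \<infinity>"
    using int unfolding real_integrable_def P Q by auto
  have ae: "AE x in M. p x \<noteq> \<infinity>" "AE x in M. q x \<noteq> \<infinity>"
    by (rule nn_integral_PInf_AE; use fin in simp)+
  have fK: "f \<in> borel_measurable (K x)" if "x \<in> space M" for x
    using f measurable_cong_sets[OF sets_kernel[OF K that] refl] by blast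
  show aeint: "AE x in M. integrable (K x) f"
    using ae AE_space by eventually_elim (use fK in \<open>auto simp: real_integrable_def p_def q_def\<close>)
  have ipq: "integrable M (\<lambda>x. enn2real (p x))" "integrable M (\<lambda>x. enn2real (q x))"
    and epq: "(\<integral>x. enn2real (p x) \<partial>M) = enn2real (\<integral>\<^sup>+x. p x \<partial>M)"
      "(\<integral>x. enn2real (q x) \<partial>M) = enn2real (\<integral>\<^sup>+x. q x \<partial>M)"
  proof -
    have "(\<integral>\<^sup>+x. ennreal (enn2real (p x)) \<partial>M) = (\<integral>\<^sup>+x. p x \<partial>M)"
      using ae(1) by (intro nn_integral_cong_AE) (auto simp: top.not_eq_extremum)
    moreover have "(\<integral>\<^sup>+x. ennreal (enn2real (q x)) \<partial>M) = (\<integral>\<^sup>+x. q x \<partial>M)"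
      using ae(2) by (intro nn_integral_cong_AE) (auto simp: top.not_eq_extremum)
    ultimately show "integrable M (\<lambda>x. enn2real (p x))" "integrable M (\<lambda>x. enn2real (q x))"
      "(\<integral>x. enn2real (p x) \<partial>M) = enn2real (\<integral>\<^sup>+x. p x \<partial>M)"
      "(\<integral>x. enn2real (q x) \<partial>M) = enn2real (\<integral>\<^sup>+x. q x \<partial>M)"
      using fin by (auto intro!: integrableI_nonneg simp: integral_eq_nn_integral top.not_eq_extremum)
  qed
  have "(\<integral>y. f y \<partial>(M \<bind> K)) = (\<integral>x. enn2real (p x) - enn2real (q x) \<partial>M)"
    unfolding real_lebesgue_integral_def[OF int] P Q using ipq epq by simp
  also have "\<dots> = (\<integral>x. (\<integral>y. f y \<partial>K x) \<partial>M)"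
  proof (rule integral_cong_AE)
    show "(\<lambda>x. \<integral>y. f y \<partial>K x) \<in> borel_measurable M"
      by (rule measurable_compose[OF K integral_measurable_subprob_algebra[OF f]])
    show "AE x in M. enn2real (p x) - enn2real (q x) = (\<integral>y. f y \<partial>K x)"
      using aeint by eventually_elim (simp add: real_lebesgue_integral_def p_def q_def)
  qed simp
  finally show "(\<integral>y. f y \<partial>(M \<bind> K)) = (\<integral>x. (\<integral>y. f y \<partial>K x) \<partial>M)" .
qed

section \<open>The value of a control as a sum along the flow\<close>

lemma stationary_control:
  assumes "h \<in> borel \<rightarrow>\<^sub>M weak_borel"
  shows "(\<lambda>_. h \<circ> fst) \<in> controls"
  using measurable_compose[OF measurable_fst assms] by (simp add: controls_def comp_def)

lemma next_law_prob_measures: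
  fixes P :: "('s::{metric_space, second_countable_topology},
               'a::{metric_space, second_countable_topology}) mf_point \<Rightarrow> 's measure"
    and R :: "('s, 'a) mf_point \<Rightarrow> real measure"
  assumes P: "P \<in> mf_points \<rightarrow>\<^sub>M weak_borel" and R: "R \<in> mf_points \<rightarrow>\<^sub>M weak_borel"
    and \<mu>: "\<mu> \<in> prob_measures"
    and h: "h \<in> borel \<rightarrow>\<^sub>M weak_borel"
  shows "next_law P \<mu> h \<in> prob_measures"
  using flow_prob_measures(1)[OF P R stationary_control[OF h] \<mu>, of "Suc 0"] by simp

text \<open>
  Only the marginal of the trajectory at time \<open>t\<close> matters.  Its integral is taken apart by
  \<open>integral_bind_real\<close>, first over the state and then over the action; the innermost law is the
  push-forward of the reward law.  Integrability over the actions is known only for almost every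
  state, so the second step is an equality almost everywhere.
\<close>

lemma expected_reward:
  fixes P :: "('s::{metric_space, second_countable_topology},
               'a::{metric_space, second_countable_topology}) mf_point \<Rightarrow> 's measure"
  assumes P: "P \<in> mf_points \<rightarrow>\<^sub>M weak_borel" and R: "R \<in> mf_points \<rightarrow>\<^sub>M weak_borel"
    and \<pi>: "\<pi> \<in> controls" and \<mu>: "\<mu> \<in> prob_measures"
    and int: "integrable (trajectory P R \<pi> \<mu>) (\<lambda>\<omega>. reward \<omega> t)"
  shows "(\<integral>\<omega>. reward \<omega> t \<partial>trajectory P R \<pi> \<mu>) =
    mean_reward R (state_flow P \<pi> \<mu> t) (\<lambda>s. \<pi> t (s, state_flow P \<pi> \<mu> t))"
proof -
  let ?T = "trajectory P R \<pi> \<mu>" and ?K = "stage_law P R \<pi> \<mu> t"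
  let ?m = "state_flow P \<pi> \<mu> t" and ?n = "action_flow P \<pi> \<mu> t"
  define f :: "'s \<times> 'a \<times> real \<Rightarrow> real" where "f = (\<lambda>x. snd (snd x))"
  have f [measurable]: "f \<in> borel_measurable stages"
    unfolding f_def by measurable
  have ev: "(\<lambda>\<omega>. \<omega> t) \<in> ?T \<rightarrow>\<^sub>M stages"
    unfolding measurable_cong_sets[OF sets_trajectory[OF P R \<pi> \<mu>] refl]
    by (intro measurable_component_singleton) simp
  have m: "?m \<in> prob_measures" and n: "?n \<in> prob_measures"
    by (rule flow_prob_measures[OF P R \<pi> \<mu>])+
  have sets_m: "sets ?m = sets borel"
    using m by (simp add: prob_measures_def)
  have pi: "(\<lambda>s. \<pi> t (s, ?m)) \<in> borel \<rightarrow>\<^sub>M prob_algebra borel"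
    by (rule measurable_control_section[OF P R \<pi> \<mu> m])
  have sets_pi: "sets (\<pi> t (s, ?m)) = sets borel" for s
    using measurable_space[OF pi] by (simp add: space_prob_algebra)
  have R1 [measurable]: "(\<lambda>x. R (fst x, ?m, snd x, ?n)) \<in> borel \<Otimes>\<^sub>M borel \<rightarrow>\<^sub>M prob_algebra borel"
    by (rule measurable_mf_section[OF P R \<pi> \<mu> R m n])
  have R2 [measurable]: "(\<lambda>a. R (s, ?m, a, ?n)) \<in> borel \<rightarrow>\<^sub>M prob_algebra borel" for s
    using measurable_compose[OF _ R1, of "\<lambda>a. (s, a)" borel] by simp
  define L where "L s a = R (s, ?m, a, ?n) \<bind> (\<lambda>r. return stages (s, a, r))" for s a
  have L: "L s \<in> \<pi> t (s, ?m) \<rightarrow>\<^sub>M subprob_algebra stages" for s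
  proof -
    have "L s \<in> borel \<rightarrow>\<^sub>M prob_algebra stages"
      unfolding L_def[abs_def] using R2
      by (rule measurable_bind_prob_space2) (simp add: split_def)
    then show ?thesis
      using measurable_prob_algebraD measurable_cong_sets[OF sets_pi refl] by blast
  qed
  have L_int: "(\<integral>y. f y \<partial>L s a) = (\<integral>r. r \<partial>R (s, ?m, a, ?n))" for s a
  proof -
    have Ra: "sets (R (s, ?m, a, ?n)) = sets borel" "prob_space (R (s, ?m, a, ?n))"
      using measurable_space[OF R2] by (auto simp: space_prob_algebra)
    have g: "(\<lambda>r. (s, a, r)) \<in> R (s, ?m, a, ?n) \<rightarrow>\<^sub>M stages"
      unfolding measurable_cong_sets[OF Ra(1) refl] by simp
    have "L s a = distr (R (s, ?m, a, ?n)) stages (\<lambda>r. (s, a, r))"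
      unfolding L_def by (rule bind_return_distr'[OF prob_space.not_empty[OF Ra(2)] g])
    then show ?thesis
      by (simp add: integral_distr[OF g f]) (simp add: f_def)
  qed
  have K_eq: "?K s = \<pi> t (s, ?m) \<bind> L s" for s
    unfolding stage_law_def L_def[abs_def] ..
  have K: "?K \<in> ?m \<rightarrow>\<^sub>M subprob_algebra stages"
    using measurable_prob_algebraD[OF measurable_stage_law[OF P R \<pi> \<mu>]]
      measurable_cong_sets[OF sets_m refl] by blast
  have marg: "distr ?T stages (\<lambda>\<omega>. \<omega> t) = ?m \<bind> ?K"
    by (rule distr_trajectory_stage[OF P R \<pi> \<mu>])
  have r: "reward \<omega> t = f (\<omega> t)" for \<omega> :: "nat \<Rightarrow> 's \<times> 'a \<times> real"
    by (simp add: reward_def f_def)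
  have int': "integrable (?m \<bind> ?K) f"
    using int unfolding marg[symmetric] r by (simp add: integrable_distr_eq[OF ev f])
  have "(\<integral>\<omega>. reward \<omega> t \<partial>?T) = (\<integral>y. f y \<partial>(?m \<bind> ?K))"
    unfolding marg[symmetric] r by (rule integral_distr[OF ev f, symmetric])
  also have "\<dots> = (\<integral>s. (\<integral>y. f y \<partial>?K s) \<partial>?m)"
    by (rule integral_bind_real[OF K f int'])
  also have "\<dots> = (\<integral>s. (\<integral>a. (\<integral>y. f y \<partial>L s a) \<partial>\<pi> t (s, ?m)) \<partial>?m)"
  proof (rule integral_cong_AE)
    show "(\<lambda>s. \<integral>y. f y \<partial>?K s) \<in> borel_measurable ?m"
      by (rule measurable_compose[OF K integral_measurable_subprob_algebra[OF f]])
    have "(\<lambda>x. \<integral>r. r \<partial>R (fst x, ?m, snd x, ?n)) \<in> borel_measurable (borel \<Otimes>\<^sub>M borel)"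
      by (rule measurable_compose[OF measurable_prob_algebraD[OF R1]
            integral_measurable_subprob_algebra]) simp
    then have *: "(\<lambda>(s, a). \<integral>y. f y \<partial>L s a) \<in> borel_measurable (borel \<Otimes>\<^sub>M borel)"
      by (simp add: L_int split_def)
    have "(\<lambda>s. \<integral>a. (\<integral>y. f y \<partial>L s a) \<partial>\<pi> t (s, ?m)) \<in> borel_measurable borel"
    proof -
      have "(\<lambda>s. \<integral>x. (\<integral>y. f y \<partial>L (fst x) (snd x))
          \<partial>distr (\<pi> t (s, ?m)) (borel \<Otimes>\<^sub>M borel) (\<lambda>a. (s, a))) \<in> borel_measurable borel"
        using * by (intro measurable_compose[OF measurable_distr2[OF _ measurable_prob_algebraD[OF pi]]
              integral_measurable_subprob_algebra]) (simp_all add: split_def)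
      moreover have "(\<integral>x. (\<integral>y. f y \<partial>L (fst x) (snd x)) \<partial>distr (\<pi> t (s, ?m)) (borel \<Otimes>\<^sub>M borel) (\<lambda>a. (s, a)))
          = (\<integral>a. (\<integral>y. f y \<partial>L s a) \<partial>\<pi> t (s, ?m))" for s
      proof -
        have "(\<lambda>a. (s, a)) \<in> \<pi> t (s, ?m) \<rightarrow>\<^sub>M borel \<Otimes>\<^sub>M borel"
          unfolding measurable_cong_sets[OF sets_pi refl] by simp
        from integral_distr[OF this *[unfolded split_def]] show ?thesis by (simp only: fst_conv snd_conv)
      qed
      ultimately show ?thesis by (simp only:)
    qed
    then show "(\<lambda>s. \<integral>a. (\<integral>y. f y \<partial>L s a) \<partial>\<pi> t (s, ?m)) \<in> borel_measurable ?m"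
      by (simp only: measurable_cong_sets[OF sets_m refl])
    show "AE s in ?m. (\<integral>y. f y \<partial>?K s) = (\<integral>a. (\<integral>y. f y \<partial>L s a) \<partial>\<pi> t (s, ?m))"
      using AE_integrable_kernel[OF K f int']
      by eventually_elim (use integral_bind_real[OF L f] in \<open>simp add: K_eq\<close>)
  qed
  also have "\<dots> = mean_reward R ?m (\<lambda>s. \<pi> t (s, ?m))"
    unfolding L_int mean_reward_def action_flow_def ..
  finally show ?thesis .
qed

text \<open>
  Finiteness of the absolute value is what Fubini needs to exchange the expectation with the
  discounted sum; after the exchange only the flow of laws is left of the process.
\<close>

lemma control_value_sums:
  fixes P :: "('s::{metric_space, second_countable_topology},
               'a::{metric_space, second_countable_topology}) mf_point \<Rightarrow> 's measure"
  assumes P: "P \<in> mf_points \<rightarrow>\<^sub>M weak_borel" and R: "R \<in> mf_points \<rightarrow>\<^sub>M weak_borel"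
    and \<pi>: "\<pi> \<in> controls" and \<mu>: "\<mu> \<in> prob_measures" and \<gamma>: "0 < \<gamma>"
    and fin: "control_abs_value \<gamma> P R \<pi> \<mu> < \<infinity>"
  shows "(\<lambda>t. \<gamma> ^ t * mean_reward R (state_flow P \<pi> \<mu> t) (\<lambda>s. \<pi> t (s, state_flow P \<pi> \<mu> t)))
    sums control_value \<gamma> P R \<pi> \<mu>"
proof -
  let ?T = "trajectory P R \<pi> \<mu>"
  have ev: "(\<lambda>\<omega>. \<omega> t) \<in> ?T \<rightarrow>\<^sub>M stages" for t
    unfolding measurable_cong_sets[OF sets_trajectory[OF P R \<pi> \<mu>] refl]
    by (intro measurable_component_singleton) simp
  have meas [measurable]: "(\<lambda>\<omega>. reward \<omega> t) \<in> borel_measurable ?T" for t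
    unfolding reward_def by (rule measurable_compose[OF ev]) simp
  have abs_eq: "\<bar>\<gamma> ^ t * x\<bar> = \<gamma> ^ t * \<bar>x\<bar>" for t x
    using \<gamma> by (simp add: abs_mult)
  have nn: "(\<integral>\<^sup>+\<omega>. (\<Sum>t. ennreal (\<gamma> ^ t * \<bar>reward \<omega> t\<bar>)) \<partial>?T) \<noteq> \<infinity>"
    using fin by (simp add: control_abs_value_def)
  have sum_nn: "(\<Sum>t. \<integral>\<^sup>+\<omega>. ennreal (\<gamma> ^ t * \<bar>reward \<omega> t\<bar>) \<partial>?T) \<noteq> \<infinity>"
    using nn by (subst (asm) nn_integral_suminf) simp_all
  have "(\<integral>\<^sup>+\<omega>. ennreal (\<gamma> ^ t * \<bar>reward \<omega> t\<bar>) \<partial>?T) \<noteq> \<infinity>" for t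
    using sum_nn ennreal_suminf_lessD[of _ top t] by (fastforce simp: top.not_eq_extremum)
  then have int: "integrable ?T (\<lambda>\<omega>. \<gamma> ^ t * reward \<omega> t)" for t
    by (intro integrableI_bounded) (auto simp: abs_eq top.not_eq_extremum)
  have summ: "AE \<omega> in ?T. summable (\<lambda>t. norm (\<gamma> ^ t * reward \<omega> t))"
  proof -
    have "AE \<omega> in ?T. (\<Sum>t. ennreal (\<gamma> ^ t * \<bar>reward \<omega> t\<bar>)) \<noteq> \<infinity>"
      by (rule nn_integral_PInf_AE[OF _ nn]) measurable
    then show ?thesis
      by eventually_elim (use \<gamma> in \<open>auto simp: abs_eq intro!: summable_suminf_not_top\<close>)
  qed
  have "ennreal (\<integral>\<omega>. norm (\<gamma> ^ t * reward \<omega> t) \<partial>?T)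
      = (\<integral>\<^sup>+\<omega>. ennreal (\<gamma> ^ t * \<bar>reward \<omega> t\<bar>) \<partial>?T)" for t
    using nn_integral_eq_integral[OF integrable_norm[OF int[of t]]] \<gamma> by (simp add: abs_eq)
  then have "summable (\<lambda>t. \<integral>\<omega>. norm (\<gamma> ^ t * reward \<omega> t) \<partial>?T)"
    using sum_nn by (intro summable_suminf_not_top) simp_all
  from sums_integral[OF int summ this]
  have "(\<lambda>t. \<integral>\<omega>. \<gamma> ^ t * reward \<omega> t \<partial>?T) sums control_value \<gamma> P R \<pi> \<mu>"
    by (simp add: control_value_def)
  moreover have "(\<integral>\<omega>. \<gamma> ^ t * reward \<omega> t \<partial>?T) = \<gamma> ^ t * mean_reward R (state_flow P \<pi> \<mu> t)
      (\<lambda>s. \<pi> t (s, state_flow P \<pi> \<mu> t))" for t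
  proof -
    have "integrable ?T (\<lambda>\<omega>. reward \<omega> t)"
      using integrable_mult_right[OF int[of t], of "inverse (\<gamma> ^ t)"] \<gamma>
      by (simp add: mult.assoc[symmetric])
    from expected_reward[OF P R \<pi> \<mu> this] show ?thesis by simp
  qed
  ultimately show ?thesis by (simp only:)
qed

section \<open>The dynamic programming step\<close>

lemma state_flow_shift:
  "state_flow P \<pi> \<mu> (Suc t) =
    state_flow P (\<lambda>t. \<pi> (Suc t)) (next_law P \<mu> (\<lambda>s. \<pi> 0 (s, \<mu>))) t"
  by (induction t) simp_all

text \<open>
  Shifting the time also shifts the flow of laws, so the tail of the sum is again the value of a
  control, started from the next law.
\<close>

lemma control_value_unfold:
  fixes P :: "('s::{metric_space, second_countable_topology},
               'a::{metric_space, second_countable_topology}) mf_point \<Rightarrow> 's measure"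
    and \<pi> :: "nat \<Rightarrow> 's \<times> 's measure \<Rightarrow> 'a measure"
  assumes P: "P \<in> mf_points \<rightarrow>\<^sub>M weak_borel" and R: "R \<in> mf_points \<rightarrow>\<^sub>M weak_borel"
    and \<pi>: "\<pi> \<in> controls" and \<mu>: "\<mu> \<in> prob_measures" and \<gamma>: "0 < \<gamma>"
    and fin: "\<And>\<pi> \<mu>. \<pi> \<in> controls \<Longrightarrow> \<mu> \<in> prob_measures \<Longrightarrow> control_abs_value \<gamma> P R \<pi> \<mu> < \<infinity>"
  defines "h \<equiv> \<lambda>s. \<pi> 0 (s, \<mu>)"
  assumes nxt: "next_law P \<mu> h \<in> prob_measures"
  shows "control_value \<gamma> P R \<pi> \<mu> =
    mean_reward R \<mu> h + \<gamma> * control_value \<gamma> P R (\<lambda>t. \<pi> (Suc t)) (next_law P \<mu> h)"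
proof -
  let ?c = "\<lambda>t. mean_reward R (state_flow P \<pi> \<mu> t) (\<lambda>s. \<pi> t (s, state_flow P \<pi> \<mu> t))"
  have shift: "(\<lambda>t. \<pi> (Suc t)) \<in> controls"
    using \<pi> by (simp add: controls_def)
  have "(\<lambda>t. \<gamma> ^ t * ?c (Suc t)) sums control_value \<gamma> P R (\<lambda>t. \<pi> (Suc t)) (next_law P \<mu> h)"
    using control_value_sums[OF P R shift nxt \<gamma> fin[OF shift nxt]]
    unfolding state_flow_shift h_def .
  from sums_mult[OF this, of \<gamma>]
  have "(\<lambda>t. \<gamma> ^ Suc t * ?c (Suc t)) sums
      (\<gamma> * control_value \<gamma> P R (\<lambda>t. \<pi> (Suc t)) (next_law P \<mu> h))"
    by (simp add: mult.assoc)
  from sums_Suc[OF this]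
  have "(\<lambda>t. \<gamma> ^ t * ?c t) sums
      (\<gamma> * control_value \<gamma> P R (\<lambda>t. \<pi> (Suc t)) (next_law P \<mu> h) + mean_reward R \<mu> h)"
    by (simp add: h_def)
  from sums_unique2[OF control_value_sums[OF P R \<pi> \<mu> \<gamma> fin[OF \<pi> \<mu>]] this] show ?thesis
    by simp
qed

lemma measurable_control_policy:
  assumes "\<pi> \<in> controls" "\<mu> \<in> prob_measures"
  shows "(\<lambda>s. \<pi> t (s, \<mu>)) \<in> borel \<rightarrow>\<^sub>M weak_borel"
proof -
  have "(\<lambda>s. (s, \<mu>)) \<in> borel \<rightarrow>\<^sub>M borel \<Otimes>\<^sub>M weak_borel"
    using assms by (intro measurable_Pair) auto
  moreover have "\<pi> t \<in> borel \<Otimes>\<^sub>M weak_borel \<rightarrow>\<^sub>M weak_borel"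
    using assms by (simp add: controls_def)
  ultimately show ?thesis by (rule measurable_compose)
qed

text \<open>
  This makes the Bellman right-hand side a lower bound: a policy for the first step and a control
  for the rest, chosen independently of each other, form one control.
\<close>

lemma controls_prepend:
  assumes "h \<in> borel \<rightarrow>\<^sub>M weak_borel" "\<pi> \<in> controls"
  shows "case_nat (h \<circ> fst) \<pi> \<in> controls"
  using assms measurable_compose[OF measurable_fst assms(1)]
  by (auto simp: controls_def comp_def split: nat.split)

theorem mainTheorem3:
  fixes P :: "('s::{metric_space, second_countable_topology},
               'a::{metric_space, second_countable_topology}) mf_point \<Rightarrow> 's measure"
    and R :: "('s, 'a) mf_point \<Rightarrow> real measure"
    and \<gamma> :: real
    and \<Omega> :: "'w::polish_space measure"
  assumes "compact (UNIV :: 's set)" and "compact (UNIV :: 'a set)"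
    and "0 < \<gamma>" and "\<gamma> < 1"
    and "P \<in> mf_points \<rightarrow>\<^sub>M weak_borel"
    and "R \<in> mf_points \<rightarrow>\<^sub>M weak_borel"
    and "prob_space \<Omega>" and "sets \<Omega> = sets borel" and "atomless \<Omega>"
    and "realizes_all_laws \<Omega> TYPE('s)"
    and "\<And>\<xi> :: 'w \<Rightarrow> 's. \<xi> \<in> borel_measurable \<Omega> \<Longrightarrow>
           (SUP \<pi>\<in>controls. control_abs_value \<gamma> P R \<pi> (distr \<Omega> borel \<xi>)) < \<infinity>"
  shows "\<forall>\<mu>\<in>prob_measures.
           optimal_value \<gamma> P R \<mu> =
             (SUP h\<in>local_policies \<gamma> P R.
                ereal (mean_reward R \<mu> h) + ereal \<gamma> * optimal_value \<gamma> P R (next_law P \<mu> h))"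
proof
  fix \<mu> :: "'s measure" assume \<mu>: "\<mu> \<in> prob_measures"
  note \<gamma> = \<open>0 < \<gamma>\<close> and P = \<open>P \<in> mf_points \<rightarrow>\<^sub>M weak_borel\<close> and R = \<open>R \<in> mf_points \<rightarrow>\<^sub>M weak_borel\<close>
  let ?v = "optimal_value \<gamma> P R" and ?J = "control_value \<gamma> P R"
  let ?B = "\<lambda>h. ereal (mean_reward R \<mu> h) + ereal \<gamma> * ?v (next_law P \<mu> h)"
  have sup_fin: "(SUP \<pi>\<in>controls. control_abs_value \<gamma> P R \<pi> \<mu>) < \<infinity>"
    if \<mu>: "\<mu> \<in> prob_measures" for \<mu> :: "'s measure"
  proof -
    obtain \<xi> where "\<xi> \<in> borel_measurable \<Omega>" "distr \<Omega> borel \<xi> = \<mu>"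
      using \<open>realizes_all_laws \<Omega> TYPE('s)\<close> \<mu> by (auto simp: realizes_all_laws_def)
    then show ?thesis using assms(11) by blast
  qed
  have fin: "control_abs_value \<gamma> P R \<pi> \<mu> < \<infinity>"
    if "\<pi> \<in> controls" "\<mu> \<in> prob_measures" for \<pi> and \<mu> :: "'s measure"
    using le_less_trans[OF SUP_upper[OF that(1)] sup_fin[OF that(2)]] .
  note unfold = control_value_unfold[OF P R _ \<mu> \<gamma> fin]
  \<comment> \<open>The supremum over all controls is finite at every law, so it bounds those starting with \<open>h\<close>.\<close>
  have policies: "local_policies \<gamma> P R = borel \<rightarrow>\<^sub>M weak_borel"
  proof -
    have "(SUP \<pi>\<in>{\<pi> \<in> controls. \<forall>s. \<forall>m\<in>prob_measures. \<pi> 0 (s, m) = h s}.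
        control_abs_value \<gamma> P R \<pi> \<mu>) < \<infinity>" if "\<mu> \<in> prob_measures" for h and \<mu> :: "'s measure"
      by (rule le_less_trans[OF SUP_subset_mono sup_fin[OF that]]) auto
    then show ?thesis by (auto simp: local_policies_def)
  qed
  show "?v \<mu> = (SUP h\<in>local_policies \<gamma> P R. ?B h)"
    unfolding policies
  proof (rule antisym)
    show "?v \<mu> \<le> (SUP h\<in>borel \<rightarrow>\<^sub>M weak_borel. ?B h)"
      unfolding optimal_value_def[of _ _ _ \<mu>]
    proof (rule SUP_least)
      fix \<pi> :: "nat \<Rightarrow> 's \<times> 's measure \<Rightarrow> 'a measure" assume \<pi>: "\<pi> \<in> controls"
      let ?h = "\<lambda>s. \<pi> 0 (s, \<mu>)"
      have h: "?h \<in> borel \<rightarrow>\<^sub>M weak_borel"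
        by (rule measurable_control_policy[OF \<pi> \<mu>])
      have "(\<lambda>t. \<pi> (Suc t)) \<in> controls"
        using \<pi> by (simp add: controls_def)
      then have "ereal (?J (\<lambda>t. \<pi> (Suc t)) (next_law P \<mu> ?h)) \<le> ?v (next_law P \<mu> ?h)"
        unfolding optimal_value_def by (rule SUP_upper)
      then have "ereal \<gamma> * ereal (?J (\<lambda>t. \<pi> (Suc t)) (next_law P \<mu> ?h))
          \<le> ereal \<gamma> * ?v (next_law P \<mu> ?h)"
        using \<gamma> by (intro ereal_mult_left_mono) auto
      moreover have "ereal (?J \<pi> \<mu>) = ereal (mean_reward R \<mu> ?h)
          + ereal \<gamma> * ereal (?J (\<lambda>t. \<pi> (Suc t)) (next_law P \<mu> ?h))"
        using unfold[OF \<pi> _ _ next_law_prob_measures[OF P R \<mu> h]] by simp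
      ultimately have "ereal (?J \<pi> \<mu>) \<le> ?B ?h"
        by (metis add_left_mono)
      also have "\<dots> \<le> (SUP h\<in>borel \<rightarrow>\<^sub>M weak_borel. ?B h)"
        using h by (rule SUP_upper)
      finally show "ereal (?J \<pi> \<mu>) \<le> (SUP h\<in>borel \<rightarrow>\<^sub>M weak_borel. ?B h)" .
    qed
    show "(SUP h\<in>borel \<rightarrow>\<^sub>M weak_borel. ?B h) \<le> ?v \<mu>"
    proof (rule SUP_least)
      fix h :: "'s \<Rightarrow> 'a measure" assume h: "h \<in> borel \<rightarrow>\<^sub>M weak_borel"
      have ne: "controls \<noteq> ({} :: (nat \<Rightarrow> 's \<times> 's measure \<Rightarrow> 'a measure) set)"
        using stationary_control[OF h] by auto
      have "?B h = (SUP \<pi>\<in>controls. ereal (mean_reward R \<mu> h) + ereal \<gamma> * ereal (?J \<pi> (next_law P \<mu> h)))"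
        unfolding optimal_value_def Sup_ereal_mult_left'[OF ne less_imp_le[OF \<gamma>]]
        by (rule SUP_ereal_add_right[OF ne, symmetric]) simp
      also have "\<dots> \<le> ?v \<mu>"
      proof (rule SUP_least)
        fix \<pi> :: "nat \<Rightarrow> 's \<times> 's measure \<Rightarrow> 'a measure" assume "\<pi> \<in> controls"
        then have \<pi>: "case_nat (h \<circ> fst) \<pi> \<in> controls"
          by (rule controls_prepend[OF h])
        have "?J (case_nat (h \<circ> fst) \<pi>) \<mu> = mean_reward R \<mu> h + \<gamma> * ?J \<pi> (next_law P \<mu> h)"
          using unfold[OF \<pi>] next_law_prob_measures[OF P R \<mu> h] by simp
        then have "ereal (mean_reward R \<mu> h) + ereal \<gamma> * ereal (?J \<pi> (next_law P \<mu> h))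
            = ereal (?J (case_nat (h \<circ> fst) \<pi>) \<mu>)"
          by simp
        also have "\<dots> \<le> ?v \<mu>"
          unfolding optimal_value_def using \<pi> by (rule SUP_upper)
        finally show "ereal (mean_reward R \<mu> h) + ereal \<gamma> * ereal (?J \<pi> (next_law P \<mu> h)) \<le> ?v \<mu>" .
      qed
      finally show "?B h \<le> ?v \<mu>" .
    qed
  qed
qed

end
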